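(* Let $T=1$ or $T=2$, and let $0<p<1$, $q=1-p$. Let $\tau_m$ be the first hitting time of the $T$-contaminated run of heads having length $m$. Then, for every $x>0$, $$P\big(\tau_m\,\alpha\,P(A_1)>x\big)\sim e^{-x}\qquad\text{as } m\to\infty .$$ Here, if $T=1$, then $\alpha=q+\frac{2p^{m-1}-1}{m}$ and $P(A_1)=m\,p^{m-1}q$; if $T=2$, then $\alpha=q-\frac{2}{m}$ and $P(A_1)=\binom{m}{2}p^{m-2}q^2$.
   Context: Let $X_1,X_2,\dots$ be independent identically distributed random variables with $P(X_i=1)=p$ (heads) and $P(X_i=0)=q=1-p$ (tails), where $p\in(0,1)$ is fixed. For a fixed non-negative integer $T$ and a positive integer $m$, $A_n=A_{n,m}$ denotes the event that there are precisely $T$ zeros among $X_n,X_{n+1},\dots,X_{n+m-1}$, i.e. that there is a $T$-contaminated run of heads of length $m$ at positions $n,\dots,n+m-1$. The first hitting time $\tau_m$ is the index of the toss at which the first $T$-contaminated run of heads of length $m$ is completed; that is, for $N\ge m$, $\{\tau_m>N\}=\bar A_1\cap\bar A_2\cap\dots\cap\bar A_{N-m+1}$, where $\bar A$ is the complement of $A$ (equivalently $\tau_m=m-1+\min\{n\ge 1: A_{n,m}\text{ occurs}\}$). The quantities $\alpha$ and $P(A_1)$ depend on $m$. The notation $a_m\sim b_m$ means $a_m/b_m\to1$ as $m\to\infty$. *)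

theory Defs
  imports "HOL-Probability.Probability" "HOL-Library.Landau_Symbols"
begin

definition contaminated_run :: "(nat \<Rightarrow> 'a \<Rightarrow> real) \<Rightarrow> nat \<Rightarrow> nat \<Rightarrow> nat \<Rightarrow> 'a \<Rightarrow> bool" where
  "contaminated_run X T m n \<omega> \<longleftrightarrow> card {i \<in> {n..<n + m}. X i \<omega> = 0} = T"

text \<open>The index of the toss completing the first run, so the run starting at toss \<open>n\<close> counts with
  \<open>m - 1 + n\<close>. Tosses are numbered from 1. The value is \<open>\<infinity>\<close> if no run ever occurs.\<close>

definition hitting_time :: "(nat \<Rightarrow> 'a \<Rightarrow> real) \<Rightarrow> nat \<Rightarrow> nat \<Rightarrow> 'a \<Rightarrow> enat" where
  "hitting_time X T m \<omega> = (INF n \<in> {n. 1 \<le> n \<and> contaminated_run X T m n \<omega>}. enat (m - 1 + n))"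

lemma hitting_time_greater_iff:
  assumes "m \<ge> 1" "N \<ge> m"
  shows "hitting_time X T m \<omega> > enat N \<longleftrightarrow> (\<forall>n\<in>{1..N - m + 1}. \<not> contaminated_run X T m n \<omega>)"
proof -
  have "hitting_time X T m \<omega> > enat N \<longleftrightarrow> enat (Suc N) \<le> hitting_time X T m \<omega>"
    by (metis Suc_ile_eq)
  also have "\<dots> \<longleftrightarrow> (\<forall>n. 1 \<le> n \<and> contaminated_run X T m n \<omega> \<longrightarrow> Suc N \<le> m - 1 + n)"
    by (auto simp: hitting_time_def le_INF_iff)
  also have "\<dots> \<longleftrightarrow> (\<forall>n\<in>{1..N - m + 1}. \<not> contaminated_run X T m n \<omega>)"
  proof -
    have "Suc N \<le> m - 1 + n \<longleftrightarrow> \<not> n \<le> N - m + 1" for n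
      using assms by linarith
    then show ?thesis by auto
  qed
  finally show ?thesis .
qed

text \<open>Only the values for \<open>T = 1\<close> and \<open>T = 2\<close> are meaningful.\<close>

definition alpha :: "nat \<Rightarrow> real \<Rightarrow> nat \<Rightarrow> real" where
  "alpha T p m =
     (if T = 1 then (1 - p) + (2 * p ^ (m - 1) - 1) / real m
      else (1 - p) - 2 / real m)"

end

theory Submission
  imports Defs
begin

text \<open>
  Write \<open>\<pi>\<close> for the probability of a run at a fixed start and \<open>G n\<close> for the probability that none of
  the starts \<open>1, \<dots>, n\<close> yields a run. The difference \<open>G n - G (n + 1)\<close> is the probability that the
  first run starts at \<open>n + 1\<close>. It is at most \<open>\<beta> * G (n - m)\<close>, where \<open>\<beta>\<close> is the probability of a run
  at \<open>n + 1\<close> but not at \<open>n\<close>, because that event is independent of the windows before \<open>n - m + 1\<close>. The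
  defect is at most the probability that in addition one of the overlapping windows starting in
  \<open>n - m + 1, \<dots>, n - 1\<close> is a run, and this is \<open>O(\<pi> / m)\<close>: if the windows at \<open>k < n\<close> and \<open>n + 1\<close> are
  runs but the one at \<open>n\<close> is not, then \<open>k, \<dots>, n\<close> and \<open>k + m, \<dots>, n + m\<close> contain the same number of
  zeros, and this number is positive. Since \<open>G (n - m) - G n \<le> m * \<pi>\<close>, the sequence \<open>G\<close> is
  geometric with ratio \<open>1 - \<beta>\<close> up to an error that vanishes for \<open>n\<close> of order \<open>1 / \<pi>\<close>. Finally
  \<open>\<beta> / \<pi> \<rightarrow> q\<close>, which is also the limit of \<open>\<alpha>\<close>.
\<close>

section \<open>Analytic preliminaries: a dominated series and the exponential limit\<close>

text \<open>With \<open>y\<close> the root of \<open>x\<close> of order \<open>Suc k\<close>, the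
  term equals \<open>(n * y ^ n) ^ k * y ^ n\<close>. Since \<open>n * y ^ n\<close> is bounded, a
  geometric series dominates.\<close>

lemma summable_power_times_geometric:
  fixes x :: real
  assumes "0 < x" "x < 1"
  shows "summable (\<lambda>n. real n ^ k * x ^ n)"
proof -
  define y where "y = root (Suc k) x"
  have y: "0 < y" "y < 1" and yx: "y ^ Suc k = x"
    using assms by (auto simp: y_def simp del: power_Suc)
  have "(\<lambda>n. real n * y ^ n) \<longlonglongrightarrow> 0"
    using y by (intro powser_times_n_limit_0) auto
  then obtain B where B: "\<And>n. norm (real n * y ^ n) \<le> B"
    using Bseq_def convergent_imp_Bseq convergentI by metis
  have "norm (real n ^ k * x ^ n) \<le> B ^ k * y ^ n" for n
  proof -
    have "real n ^ k * x ^ n = (real n * y ^ n) ^ k * y ^ n"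
      by (simp add: power_mult_distrib flip: yx power_mult power_add) (simp add: mult.commute add.commute)
    also have "\<dots> \<le> B ^ k * y ^ n"
      using B[of n] y by (intro mult_right_mono power_mono) auto
    finally show ?thesis using assms by simp
  qed
  moreover have "summable (\<lambda>n. B ^ k * y ^ n)"
    using y by (intro summable_mult summable_geometric) auto
  ultimately show ?thesis
    using summable_comparison_test'[of "\<lambda>n. B ^ k * y ^ n" 0 "\<lambda>n. real n ^ k * x ^ n"] by blast
qed

text \<open>Once \<open>\<beta> m < 1 / 2\<close>, the logarithm \<open>ln (1 - \<beta> m)\<close>
  lies between \<open>- \<beta> m - 2 * (\<beta> m)\<^sup>2\<close> and \<open>- \<beta> m\<close>.
  After multiplication by \<open>j m\<close> the quadratic term vanishes in the limit, because
  \<open>j m * \<beta> m\<close> converges and \<open>\<beta> m\<close> tends to 0.\<close>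

lemma power_one_minus_tendsto_exp:
  fixes \<beta> :: "nat \<Rightarrow> real" and j :: "nat \<Rightarrow> nat"
  assumes \<beta>: "\<beta> \<longlonglongrightarrow> 0" and nonneg: "\<And>m. 0 \<le> \<beta> m" and z: "(\<lambda>m. real (j m) * \<beta> m) \<longlonglongrightarrow> z"
  shows "(\<lambda>m. (1 - \<beta> m) ^ j m) \<longlonglongrightarrow> exp (- z)"
proof -
  have small: "\<forall>\<^sub>F m in sequentially. \<beta> m < 1 / 2"
    using order_tendstoD(2)[OF \<beta>, of "1 / 2"] by simp
  have "(\<lambda>m. real (j m) * ln (1 - \<beta> m)) \<longlonglongrightarrow> - z"
  proof (rule tendsto_sandwich)
    have "(\<lambda>m. - (real (j m) * \<beta> m) - 2 * (real (j m) * \<beta> m * \<beta> m)) \<longlonglongrightarrow> - z - 2 * (z * 0)"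
      by (intro tendsto_intros z \<beta>)
    then show "(\<lambda>m. - (real (j m) * \<beta> m) - 2 * (real (j m) * \<beta> m * \<beta> m)) \<longlonglongrightarrow> - z" by simp
    show "(\<lambda>m. - (real (j m) * \<beta> m)) \<longlonglongrightarrow> - z" by (intro tendsto_minus z)
    show "\<forall>\<^sub>F m in sequentially. - (real (j m) * \<beta> m) - 2 * (real (j m) * \<beta> m * \<beta> m) \<le> real (j m) * ln (1 - \<beta> m)"
      using small
    proof eventually_elim
      case (elim m)
      then have "real (j m) * (- \<beta> m - 2 * (\<beta> m)\<^sup>2) \<le> real (j m) * ln (1 - \<beta> m)"
        using nonneg by (intro mult_left_mono ln_one_minus_pos_lower_bound) auto
      then show ?case by (simp add: algebra_simps power2_eq_square)
    qed
    show "\<forall>\<^sub>F m in sequentially. real (j m) * ln (1 - \<beta> m) \<le> - (real (j m) * \<beta> m)"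
      using small
    proof eventually_elim
      case (elim m)
      then have "real (j m) * ln (1 - \<beta> m) \<le> real (j m) * (- \<beta> m)"
        using ln_le_minus_one[of "1 - \<beta> m"] by (intro mult_left_mono) auto
      then show ?case by simp
    qed
  qed
  then have "(\<lambda>m. exp (real (j m) * ln (1 - \<beta> m))) \<longlonglongrightarrow> exp (- z)"
    by (rule tendsto_exp)
  moreover have "\<forall>\<^sub>F m in sequentially. exp (real (j m) * ln (1 - \<beta> m)) = (1 - \<beta> m) ^ j m"
    using small by eventually_elim (simp add: exp_of_nat_mult)
  ultimately show ?thesis by (rule Lim_transform_eventually)
qed

section \<open>Zero positions in blocks of tosses and their independence\<close>

locale iid_tosses = prob_space M for M :: "'a measure" +
  fixes X :: "nat \<Rightarrow> 'a \<Rightarrow> real" and q :: real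
  assumes indep: "indep_vars (\<lambda>_. borel) X {1..}"
    and prob_zero: "\<And>i. i \<ge> 1 \<Longrightarrow> prob {\<omega> \<in> space M. X i \<omega> = 0} = q"
    and q_pos: "0 < q" and q_less: "q < 1"
begin

text \<open>The random set is kept, not just its cardinality: every window inside \<open>K\<close>
  is recovered by intersection, so an event about several overlapping windows is a predicate of this
  one variable with finitely many values.\<close>

definition zeros :: "nat set \<Rightarrow> 'a \<Rightarrow> nat set" where
  "zeros K \<omega> = {i \<in> K. X i \<omega> = 0}"

text \<open>The binomial law with a zero counted as a success. For \<open>c > l\<close> the
  coefficient makes the value 0.\<close>

definition binom_mass :: "nat \<Rightarrow> nat \<Rightarrow> real" where
  "binom_mass l c = real (l choose c) * q ^ c * (1 - q) ^ (l - c)"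

lemma binom_mass_nonneg: "0 \<le> binom_mass l c"
  using q_pos q_less by (simp add: binom_mass_def)

lemma finite_zeros [simp]: "finite K \<Longrightarrow> finite (zeros K \<omega>)"
  by (simp add: zeros_def)

lemma zeros_Int: "J \<subseteq> K \<Longrightarrow> zeros K \<omega> \<inter> J = zeros J \<omega>"
  by (auto simp: zeros_def)

lemma zeros_Un: "zeros (J \<union> K) \<omega> = zeros J \<omega> \<union> zeros K \<omega>"
  by (auto simp: zeros_def)

lemma card_zeros_Un:
  assumes "finite J" "finite K" "J \<inter> K = {}"
  shows "card (zeros (J \<union> K) \<omega>) = card (zeros J \<omega>) + card (zeros K \<omega>)"
  unfolding zeros_Un using assms by (intro card_Un_disjoint) (auto simp: zeros_def)

text \<open>The target is finite and discrete, so preimages of singletons suffice, and each of these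
  is a finite conjunction of conditions on single coordinates.\<close>

lemma measurable_coordinate_zeros:
  assumes "finite K"
  shows "(\<lambda>g. {i \<in> K. g i = (0::real)}) \<in> PiM K (\<lambda>_. borel) \<rightarrow>\<^sub>M count_space (Pow K)"
proof (subst measurable_count_space_eq2)
  show "finite (Pow K)" using assms by simp
  have "(\<lambda>g. {i \<in> K. g i = (0::real)}) -` {S} \<inter> space (PiM K (\<lambda>_. borel))
      \<in> sets (PiM K (\<lambda>_. borel))" if "S \<subseteq> K" for S
  proof -
    have "(\<lambda>g. {i \<in> K. g i = (0::real)}) -` {S} \<inter> space (PiM K (\<lambda>_. borel)) =
        {g \<in> space (PiM K (\<lambda>_. borel)). \<forall>i\<in>K. (g i = 0) = (i \<in> S)}"
      using that by auto
    also have "\<dots> \<in> sets (PiM K (\<lambda>_. borel))"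
      using assms by measurable
    finally show ?thesis .
  qed
  then show "(\<lambda>g. {i \<in> K. g i = (0::real)}) \<in> space (PiM K (\<lambda>_. borel)) \<rightarrow> Pow K \<and>
      (\<forall>a\<in>Pow K. (\<lambda>g. {i \<in> K. g i = (0::real)}) -` {a} \<inter> space (PiM K (\<lambda>_. borel))
        \<in> sets (PiM K (\<lambda>_. borel)))"
    by auto
qed

text \<open>Disjoint blocks of an independent family are independent, and each zero set is a
  measurable function of its own block.\<close>

lemma indep_var_zeros:
  assumes "finite J" "finite K" "J \<subseteq> {1..}" "K \<subseteq> {1..}" "J \<inter> K = {}"
  shows "indep_var (count_space (Pow J)) (zeros J) (count_space (Pow K)) (zeros K)"
proof -
  have "indep_var (PiM J (\<lambda>_. borel)) (\<lambda>\<omega>. restrict (\<lambda>i. X i \<omega>) J)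
                  (PiM K (\<lambda>_. borel)) (\<lambda>\<omega>. restrict (\<lambda>i. X i \<omega>) K)"
    using assms by (intro indep_var_restrict[OF indep]) auto
  from indep_var_compose[OF this measurable_coordinate_zeros measurable_coordinate_zeros]
  have "indep_var (count_space (Pow J)) ((\<lambda>g. {i \<in> J. g i = 0}) \<circ> (\<lambda>\<omega>. restrict (\<lambda>i. X i \<omega>) J))
                  (count_space (Pow K)) ((\<lambda>g. {i \<in> K. g i = 0}) \<circ> (\<lambda>\<omega>. restrict (\<lambda>i. X i \<omega>) K))"
    using assms by simp
  moreover have "(\<lambda>g. {i \<in> L. g i = 0}) \<circ> (\<lambda>\<omega>. restrict (\<lambda>i. X i \<omega>) L) = zeros L" for L
    by (auto simp: zeros_def fun_eq_iff)
  ultimately show ?thesis by simp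
qed

lemma zeros_event:
  assumes "finite K" "K \<subseteq> {1..}"
  shows "{\<omega> \<in> space M. Q (zeros K \<omega>)} \<in> events"
proof -
  \<comment> \<open>Independence from the empty block is invoked for the measurability of
    \<open>zeros K\<close> that it contains.\<close>
  have "zeros K \<in> M \<rightarrow>\<^sub>M count_space (Pow K)"
    using indep_var_rv1[OF indep_var_zeros[of K "{}"]] assms by simp
  then have "zeros K -` {S \<in> Pow K. Q S} \<inter> space M \<in> events"
    by (rule measurable_sets) auto
  also have "zeros K -` {S \<in> Pow K. Q S} \<inter> space M = {\<omega> \<in> space M. Q (zeros K \<omega>)}"
    by (auto simp: zeros_def)
  finally show ?thesis .
qed

text \<open>Any \<open>Q\<close> and \<open>R\<close> are admissible because all subsets of a
  discrete space are measurable. The freedom in their choice covers every condition on windows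
  inside two disjoint blocks.\<close>

lemma prob_zeros_indep:
  assumes "finite J" "finite K" "J \<subseteq> {1..}" "K \<subseteq> {1..}" "J \<inter> K = {}"
  shows "\<P>(\<omega> in M. Q (zeros J \<omega>) \<and> R (zeros K \<omega>)) =
         \<P>(\<omega> in M. Q (zeros J \<omega>)) * \<P>(\<omega> in M. R (zeros K \<omega>))"
proof -
  have *: "zeros L -` {S \<in> Pow L. P S} \<inter> space M = {\<omega> \<in> space M. P (zeros L \<omega>)}" for L P
    by (auto simp: zeros_def)
  have "(\<lambda>\<omega>. (zeros J \<omega>, zeros K \<omega>)) -` ({S \<in> Pow J. Q S} \<times> {S \<in> Pow K. R S}) \<inter> space M =
      {\<omega> \<in> space M. Q (zeros J \<omega>) \<and> R (zeros K \<omega>)}"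
    by (auto simp: zeros_def)
  moreover have "{S \<in> Pow L. P S} \<in> sets (count_space (Pow L))" for L :: "nat set" and P
    by auto
  note indep_varD[OF indep_var_zeros[OF assms] this[of J Q] this[of K R]]
  ultimately show ?thesis
    unfolding * by (simp only:)
qed

section \<open>The binomial law of zero counts\<close>

lemma binom_mass_Suc_0: "binom_mass (Suc l) 0 = (1 - q) * binom_mass l 0"
  by (simp add: binom_mass_def)

text \<open>Pascal's rule, read as conditioning on one toss.\<close>

lemma binom_mass_Suc_Suc: "binom_mass (Suc l) (Suc c) = q * binom_mass l c + (1 - q) * binom_mass l (Suc c)"
\<comment> \<open>For \<open>c \<ge> l\<close> the last summand is 0. This case is separate because
  \<open>l - Suc c\<close> is then truncated.\<close>
proof (cases "c < l")
  case True
  then have "(1 - q) ^ (l - c) = (1 - q) * (1 - q) ^ (l - Suc c)"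
    by (metis Suc_diff_Suc power_Suc)
  note pow = this
  show ?thesis using q_pos q_less by (simp add: binom_mass_def pow) (simp add: algebra_simps)
next
  case False
  then show ?thesis by (simp add: binom_mass_def algebra_simps)
qed

text \<open>The inserted toss is independent of the remaining block, so the probabilities satisfy
  the recursion of \<open>binom_mass_Suc_0\<close> and \<open>binom_mass_Suc_Suc\<close>.\<close>

lemma prob_card_zeros:
  assumes "finite K" "K \<subseteq> {1..}"
  shows "\<P>(\<omega> in M. card (zeros K \<omega>) = c) = binom_mass (card K) c"
  using assms
proof (induction K arbitrary: c rule: finite_induct)
  case empty
  then show ?case by (cases c) (auto simp: binom_mass_def zeros_def prob_space)
next
  case (insert i K)
  have i: "{i} \<subseteq> {1..}" "K \<subseteq> {1..}" "i \<ge> 1" and disj: "{i} \<inter> K = {}"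
    using insert by auto
  have card: "card (zeros (insert i K) \<omega>) = of_bool (i \<in> zeros {i} \<omega>) + card (zeros K \<omega>)" for \<omega>
    using card_zeros_Un[of "{i}" K \<omega>] insert disj
    by (cases "X i \<omega> = 0") (auto simp: zeros_def Collect_conv_if)
  have zero: "\<P>(\<omega> in M. i \<in> zeros {i} \<omega>) = q"
    using prob_zero[OF i(3)] by (simp add: zeros_def)
  have nonzero: "\<P>(\<omega> in M. i \<notin> zeros {i} \<omega>) = 1 - q"
    using zero prob_neg[OF zeros_event[of "{i}" "\<lambda>S. i \<in> S"]] i by simp
  have prod: "\<P>(\<omega> in M. Q (zeros {i} \<omega>) \<and> card (zeros K \<omega>) = d) =
      \<P>(\<omega> in M. Q (zeros {i} \<omega>)) * binom_mass (card K) d" for Q d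
    using prob_zeros_indep[of "{i}" K Q "\<lambda>S. card S = d"] insert i by simp
  show ?case
  proof (cases c)
    case 0
    have "\<P>(\<omega> in M. card (zeros (insert i K) \<omega>) = c) =
        \<P>(\<omega> in M. i \<notin> zeros {i} \<omega> \<and> card (zeros K \<omega>) = 0)"
      unfolding card 0 by (intro arg_cong[where f = prob]) auto
    also have "\<dots> = (1 - q) * binom_mass (card K) 0"
      by (subst prod) (simp add: nonzero)
    finally show ?thesis
      using insert binom_mass_Suc_0 0 by simp
  next
    case (Suc d)
    have ev: "{\<omega> \<in> space M. Q (zeros {i} \<omega>) \<and> card (zeros K \<omega>) = d} \<in> events" for Q d
      using zeros_event[of "{i}" Q] zeros_event[of K "\<lambda>S. card S = d"] insert i
      by (simp add: Collect_conj_eq2) 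
    have "\<P>(\<omega> in M. card (zeros (insert i K) \<omega>) = c) =
        prob ({\<omega> \<in> space M. i \<in> zeros {i} \<omega> \<and> card (zeros K \<omega>) = d} \<union>
          {\<omega> \<in> space M. i \<notin> zeros {i} \<omega> \<and> card (zeros K \<omega>) = Suc d})"
      unfolding card Suc by (intro arg_cong[where f = prob]) auto
    also have "\<dots> = \<P>(\<omega> in M. i \<in> zeros {i} \<omega> \<and> card (zeros K \<omega>) = d) +
        \<P>(\<omega> in M. i \<notin> zeros {i} \<omega> \<and> card (zeros K \<omega>) = Suc d)"
      by (intro finite_measure_Union ev) auto
    also have "\<dots> = q * binom_mass (card K) d + (1 - q) * binom_mass (card K) (Suc d)"
      by (simp only: prod[of "\<lambda>S. i \<in> S"] prod[of "\<lambda>S. i \<notin> S"] zero nonzero)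
    finally show ?thesis
      using insert binom_mass_Suc_Suc Suc by simp
  qed
qed

text \<open>Two-block independence is applied twice, first to \<open>I\<close> against
  \<open>J \<union> K\<close> and then to \<open>J\<close> against \<open>K\<close>.\<close>

lemma prob_card_zeros3:
  assumes "finite I" "finite J" "finite K" "I \<subseteq> {1..}" "J \<subseteq> {1..}" "K \<subseteq> {1..}"
    and "I \<inter> J = {}" "I \<inter> K = {}" "J \<inter> K = {}"
  shows "\<P>(\<omega> in M. card (zeros I \<omega>) = a \<and> card (zeros J \<omega>) = c \<and> card (zeros K \<omega>) = d) =
         binom_mass (card I) a * binom_mass (card J) c * binom_mass (card K) d"
proof -
  have "\<P>(\<omega> in M. card (zeros I \<omega>) = a \<and> card (zeros J \<omega>) = c \<and> card (zeros K \<omega>) = d) =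
      \<P>(\<omega> in M. card (zeros I \<omega>) = a \<and>
        (card (zeros (J \<union> K) \<omega> \<inter> J) = c \<and> card (zeros (J \<union> K) \<omega> \<inter> K) = d))"
    by (simp add: zeros_Int)
  also have "\<dots> = \<P>(\<omega> in M. card (zeros I \<omega>) = a) *
      \<P>(\<omega> in M. card (zeros (J \<union> K) \<omega> \<inter> J) = c \<and> card (zeros (J \<union> K) \<omega> \<inter> K) = d)"
    using assms
    by (intro prob_zeros_indep[of I "J \<union> K" "\<lambda>S. card S = a"
          "\<lambda>S. card (S \<inter> J) = c \<and> card (S \<inter> K) = d"]) auto
  also have "\<P>(\<omega> in M. card (zeros (J \<union> K) \<omega> \<inter> J) = c \<and> card (zeros (J \<union> K) \<omega> \<inter> K) = d) =
      \<P>(\<omega> in M. card (zeros J \<omega>) = c) * \<P>(\<omega> in M. card (zeros K \<omega>) = d)"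
    using assms prob_zeros_indep[of J K "\<lambda>S. card S = c" "\<lambda>S. card S = d"]
    by (simp add: zeros_Int)
  finally show ?thesis
    using assms by (simp only: prob_card_zeros mult.assoc)
qed

section \<open>Runs and the absence of runs\<close>

abbreviation run :: "nat \<Rightarrow> nat \<Rightarrow> nat \<Rightarrow> 'a \<Rightarrow> bool" where
  "run \<equiv> contaminated_run X"

lemma run_iff: "run T m k \<omega> \<longleftrightarrow> card (zeros {k..<k + m} \<omega>) = T"
  by (simp add: contaminated_run_def zeros_def)

text \<open>Brings several windows into the form required by \<open>zeros_event\<close> and
  \<open>prob_zeros_indep\<close>, as conditions on one common random set.\<close>

lemma run_iff_Int: "{k..<k + m} \<subseteq> K \<Longrightarrow> run T m k \<omega> \<longleftrightarrow> card (zeros K \<omega> \<inter> {k..<k + m}) = T"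
  by (simp add: run_iff zeros_Int)

lemma run_event: "k \<ge> 1 \<Longrightarrow> {\<omega> \<in> space M. run T m k \<omega>} \<in> events"
  unfolding run_iff by (intro zeros_event) auto

lemma prob_run: "k \<ge> 1 \<Longrightarrow> \<P>(\<omega> in M. run T m k \<omega>) = binom_mass m T"
  unfolding run_iff by (subst prob_card_zeros) auto

text \<open>The probability is \<open>G n\<close> of the overview. For
  \<open>N \<ge> m \<ge> 1\<close> and \<open>n = N - m + 1\<close> this is the event that the
  hitting time exceeds \<open>N\<close>.\<close>

definition no_run :: "nat \<Rightarrow> nat \<Rightarrow> nat \<Rightarrow> 'a set" where
  "no_run T m n = {\<omega> \<in> space M. \<forall>k\<in>{1..n}. \<not> run T m k \<omega>}"

lemma no_run_event: "no_run T m n \<in> events"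
proof -
  have "no_run T m n = {\<omega> \<in> space M. \<forall>k\<in>{1..n}. card (zeros {1..<n + m} \<omega> \<inter> {k..<k + m}) \<noteq> T}"
    unfolding no_run_def by (intro Collect_cong conj_cong ball_cong refl) (simp add: run_iff_Int)
  also have "\<dots> \<in> events"
    by (intro zeros_event) auto
  finally show ?thesis .
qed

lemma prob_no_run_diff:
  "prob (no_run T m n) - prob (no_run T m (Suc n)) = \<P>(\<omega> in M. \<omega> \<in> no_run T m n \<and> run T m (Suc n) \<omega>)"
proof -
  have "prob (no_run T m n - no_run T m (Suc n)) = prob (no_run T m n) - prob (no_run T m (Suc n))"
    by (intro finite_measure_Diff no_run_event) (auto simp: no_run_def)
  moreover have "no_run T m n - no_run T m (Suc n) =
      {\<omega> \<in> space M. \<omega> \<in> no_run T m n \<and> run T m (Suc n) \<omega>}"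
    by (auto simp: no_run_def atLeastAtMostSuc_conv)
  ultimately show ?thesis by simp
qed

lemma prob_no_run_antimono: "n \<le> n' \<Longrightarrow> prob (no_run T m n') \<le> prob (no_run T m n)"
  by (intro finite_measure_mono no_run_event) (auto simp: no_run_def)

text \<open>Each additional start costs at most the probability of a run there, and \<open>j\<close>
  such losses add up.\<close>

lemma prob_no_run_lag: "prob (no_run T m n) - prob (no_run T m (n + j)) \<le> real j * binom_mass m T"
proof (induction j)
  case (Suc j)
  have "prob (no_run T m (n + j)) - prob (no_run T m (n + Suc j)) \<le> \<P>(\<omega> in M. run T m (Suc (n + j)) \<omega>)"
    using prob_no_run_diff[of T m "n + j"]
    by (auto intro!: finite_measure_mono run_event)
  also have "\<dots> = binom_mass m T" by (subst prob_run) auto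
  finally show ?case using Suc by (simp add: algebra_simps)
qed auto

section \<open>Onset of a run and earlier overlapping runs\<close>

text \<open>The \<beta> of the overview. The first summand belongs to a zero leaving the window, the
  second to a zero entering it.\<close>

definition onset_prob :: "nat \<Rightarrow> nat \<Rightarrow> real" where
  "onset_prob T m = q * (1 - q) * (binom_mass (m - 1) T + binom_mass (m - 1) (T - 1))"

text \<open>The windows at \<open>n\<close> and \<open>n + 1\<close> share \<open>m - 1\<close>
  tosses. Either these hold \<open>T\<close> zeros, toss \<open>n\<close> is a zero and toss
  \<open>n + m\<close> is not, or they hold \<open>T - 1\<close> zeros and the roles of the end
  tosses are swapped.\<close>

lemma prob_onset:
  assumes "m \<ge> 1" "n \<ge> 1" "T \<ge> 1"
  shows "\<P>(\<omega> in M. \<not> run T m n \<omega> \<and> run T m (Suc n) \<omega>) = onset_prob T m"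
proof -
  let ?J = "{Suc n..<n + m}"
  let ?E = "\<lambda>a c d. {\<omega> \<in> space M. card (zeros {n} \<omega>) = a \<and> card (zeros ?J \<omega>) = c \<and>
      card (zeros {n + m} \<omega>) = d}"
  have le: "card (zeros {k} \<omega>) \<le> 1" for k \<omega>
    using card_mono[of "{k}" "zeros {k} \<omega>"] by (auto simp: zeros_def)
  have iff: "(a + c \<noteq> T \<and> c + d = T) \<longleftrightarrow> (a = 1 \<and> c = T \<and> d = 0) \<or> (a = 0 \<and> c = T - 1 \<and> d = 1)"
    if "a \<le> 1" "d \<le> 1" for a c d :: nat
    using that assms by arith
  have mass_1: "binom_mass 1 0 = 1 - q" "binom_mass 1 1 = q"
    by (simp_all add: binom_mass_def)
  have J1: "{n..<n + m} = {n} \<union> ?J" and J2: "{Suc n..<Suc n + m} = ?J \<union> {n + m}"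
    using assms by auto
  have c1: "card (zeros {n..<n + m} \<omega>) = card (zeros {n} \<omega>) + card (zeros ?J \<omega>)"
    and c2: "card (zeros {Suc n..<Suc n + m} \<omega>) = card (zeros ?J \<omega>) + card (zeros {n + m} \<omega>)" for \<omega>
    unfolding J1 J2 by (intro card_zeros_Un; simp)+
  have E: "prob (?E a c d) = binom_mass 1 a * binom_mass (m - 1) c * binom_mass 1 d" for a c d
    using assms by (subst prob_card_zeros3) auto
  have ev: "?E a c d \<in> events" for a c d
  proof -
    let ?L = "{n..n + m}"
    have "?E a c d = {\<omega> \<in> space M. card (zeros ?L \<omega> \<inter> {n}) = a \<and> card (zeros ?L \<omega> \<inter> ?J) = c \<and>
      card (zeros ?L \<omega> \<inter> {n + m}) = d}"
      by (subst (1 2 3) zeros_Int) auto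
    also have "\<dots> \<in> events" using assms by (intro zeros_event) auto
    finally show ?thesis .
  qed
  have "\<not> run T m n \<omega> \<and> run T m (Suc n) \<omega> \<longleftrightarrow>
      (card (zeros {n} \<omega>) = 1 \<and> card (zeros ?J \<omega>) = T \<and> card (zeros {n + m} \<omega>) = 0) \<or>
      (card (zeros {n} \<omega>) = 0 \<and> card (zeros ?J \<omega>) = T - 1 \<and> card (zeros {n + m} \<omega>) = 1)" for \<omega>
    unfolding run_iff c1 c2 by (rule iff[OF le le])
  then have "{\<omega> \<in> space M. \<not> run T m n \<omega> \<and> run T m (Suc n) \<omega>} = ?E 1 T 0 \<union> ?E 0 (T - 1) 1"
    by (simp only:) blast
  then have "\<P>(\<omega> in M. \<not> run T m n \<omega> \<and> run T m (Suc n) \<omega>) = prob (?E 1 T 0 \<union> ?E 0 (T - 1) 1)"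
    by (rule arg_cong)
  also have "\<dots> = prob (?E 1 T 0) + prob (?E 0 (T - 1) 1)"
    by (intro finite_measure_Union ev) auto
  also have "\<dots> = q * binom_mass (m - 1) T * (1 - q) + (1 - q) * binom_mass (m - 1) (T - 1) * q"
    by (simp only: E mass_1)
  also have "\<dots> = onset_prob T m"
    by (simp add: onset_prob_def algebra_simps)
  finally show ?thesis .
qed

text \<open>For the overlapping run at \<open>k < n\<close>, the index \<open>i\<close> is \<open>n - k\<close>, and \<open>c\<close> is the number of zeros in
  each of the two blocks \<open>k, \<dots>, n\<close> and \<open>k + m, \<dots>, n + m\<close>.\<close>

definition relapse_bound :: "nat \<Rightarrow> nat \<Rightarrow> real" where
  "relapse_bound T m = (\<Sum>i\<in>{1..<m}. \<Sum>c\<in>{1..T}. binom_mass (Suc i) c * binom_mass (m - 1 - i) (T - c) * binom_mass (Suc i) c)"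

text \<open>A union bound over \<open>i\<close> and \<open>c\<close>. The window at
  \<open>n - i\<close> is \<open>?A i \<union> ?B i\<close> and the window at \<open>n + 1\<close>
  is \<open>?B i \<union> ?C i\<close>; as both are runs, the outer blocks have the same count
  \<open>c\<close>.\<close>

lemma prob_relapse_le:
  assumes "1 \<le> m" "m \<le> n"
  shows "\<P>(\<omega> in M. \<not> run T m n \<omega> \<and> run T m (Suc n) \<omega> \<and> (\<exists>k\<in>{n - m<..<n}. run T m k \<omega>))
         \<le> relapse_bound T m"
proof -
  let ?A = "\<lambda>i. {n - i..n}" and ?B = "\<lambda>i. {Suc n..<n - i + m}" and ?C = "\<lambda>i. {n - i + m..n + m}"
  define E where "E = (\<lambda>i c. {\<omega> \<in> space M. card (zeros (?A i) \<omega>) = c \<and> card (zeros (?B i) \<omega>) = T - c \<and>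
      card (zeros (?C i) \<omega>) = c})"
  have ev: "E i c \<in> events" if "i \<in> {1..<m}" for i c
  proof -
    let ?L = "{n - i..n + m}"
    have "E i c = {\<omega> \<in> space M. card (zeros ?L \<omega> \<inter> ?A i) = c \<and> card (zeros ?L \<omega> \<inter> ?B i) = T - c \<and>
      card (zeros ?L \<omega> \<inter> ?C i) = c}"
      unfolding E_def using assms that by (subst (1 2 3) zeros_Int) auto
    also have "\<dots> \<in> events" using assms that by (intro zeros_event) auto
    finally show ?thesis .
  qed
  have prob_E: "prob (E i c) = binom_mass (Suc i) c * binom_mass (m - 1 - i) (T - c) * binom_mass (Suc i) c"
    if "i \<in> {1..<m}" for i c
  proof -
    have card: "card (?A i) = Suc i" "card (?B i) = m - 1 - i" "card (?C i) = Suc i"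
      using assms that by auto
    have "prob (E i c) = binom_mass (card (?A i)) c * binom_mass (card (?B i)) (T - c) * binom_mass (card (?C i)) c"
      unfolding E_def using assms that by (intro prob_card_zeros3) auto
    then show ?thesis by (simp only: card)
  qed
  have "{\<omega> \<in> space M. \<not> run T m n \<omega> \<and> run T m (Suc n) \<omega> \<and> (\<exists>k\<in>{n - m<..<n}. run T m k \<omega>)}
      \<subseteq> (\<Union>i\<in>{1..<m}. \<Union>c\<in>{1..T}. E i c)"
  proof
    fix \<omega> assume "\<omega> \<in> {\<omega> \<in> space M. \<not> run T m n \<omega> \<and> run T m (Suc n) \<omega> \<and> (\<exists>k\<in>{n - m<..<n}. run T m k \<omega>)}"
    then obtain k where \<omega>: "\<omega> \<in> space M" "\<not> run T m n \<omega>" "run T m (Suc n) \<omega>" "run T m k \<omega>"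
      and k: "n - m < k" "k < n" by auto
    define i where "i = n - k"
    have i: "i \<in> {1..<m}" and ki: "k = n - i" using assms k by (auto simp: i_def)
    have "{k..<k + m} = ?A i \<union> ?B i" "{Suc n..<Suc n + m} = ?B i \<union> ?C i"
      using k i assms by (auto simp: ki)
    then have c1: "card (zeros {k..<k + m} \<omega>) = card (zeros (?A i) \<omega>) + card (zeros (?B i) \<omega>)"
      and c2: "card (zeros {Suc n..<Suc n + m} \<omega>) = card (zeros (?B i) \<omega>) + card (zeros (?C i) \<omega>)"
      using i assms by (auto intro!: card_zeros_Un)
    have A: "card (zeros (?A i) \<omega>) + card (zeros (?B i) \<omega>) = T"
      and C: "card (zeros (?C i) \<omega>) = card (zeros (?A i) \<omega>)"
      using c1 c2 \<omega> unfolding run_iff by auto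
    \<comment> \<open>Otherwise tosses \<open>n\<close> and \<open>n + m\<close> are both non-zero,
      and the windows at \<open>n\<close> and \<open>n + 1\<close> have the same zeros although only
      the second is a run.\<close>
    have "card (zeros (?A i) \<omega>) \<noteq> 0"
    proof
      assume 0: "card (zeros (?A i) \<omega>) = 0"
      with C have "zeros (?A i) \<omega> = {}" "zeros (?C i) \<omega> = {}" by auto
      then have nz: "X n \<omega> \<noteq> 0" "X (n + m) \<omega> \<noteq> 0" by (auto simp: zeros_def)
      have "zeros {n..<n + m} \<omega> = zeros {Suc n..<Suc n + m} \<omega>"
      proof (intro set_eqI iffI)
        fix j assume "j \<in> zeros {n..<n + m} \<omega>"
        with nz show "j \<in> zeros {Suc n..<Suc n + m} \<omega>"
          by (cases "j = n") (auto simp: zeros_def)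
      next
        fix j assume "j \<in> zeros {Suc n..<Suc n + m} \<omega>"
        with nz show "j \<in> zeros {n..<n + m} \<omega>"
          by (cases "j = n + m") (auto simp: zeros_def)
      qed
      then show False using \<omega> by (simp add: run_iff)
    qed
    then have "card (zeros (?A i) \<omega>) \<in> {1..T}"
      using A unfolding atLeastAtMost_iff by linarith
    moreover have "\<omega> \<in> E i (card (zeros (?A i) \<omega>))"
      using A C \<omega>(1) by (simp add: E_def)
    ultimately show "\<omega> \<in> (\<Union>i\<in>{1..<m}. \<Union>c\<in>{1..T}. E i c)" using i by blast
  qed
  then have "\<P>(\<omega> in M. \<not> run T m n \<omega> \<and> run T m (Suc n) \<omega> \<and> (\<exists>k\<in>{n - m<..<n}. run T m k \<omega>))
      \<le> prob (\<Union>i\<in>{1..<m}. \<Union>c\<in>{1..T}. E i c)"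
    using ev by (intro finite_measure_mono sets.finite_UN) auto
  also have "\<dots> \<le> (\<Sum>i\<in>{1..<m}. prob (\<Union>c\<in>{1..T}. E i c))"
    using ev by (intro finite_measure_subadditive_finite) auto
  also have "\<dots> \<le> (\<Sum>i\<in>{1..<m}. \<Sum>c\<in>{1..T}. prob (E i c))"
    using ev by (intro sum_mono finite_measure_subadditive_finite) auto
  also have "\<dots> = relapse_bound T m"
    unfolding relapse_bound_def by (intro sum.cong refl prob_E)
  finally show ?thesis .
qed

section \<open>Recursion and geometric approximation for the no-run probability\<close>

text \<open>\<open>?W\<close> says that the first run starts at \<open>n + 1\<close>, while
  \<open>?V\<close> forgets the starts strictly between \<open>n - m\<close> and \<open>n\<close>.
  Both estimates follow from \<open>?W \<subseteq> ?V\<close> and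
  \<open>?V \<subseteq> ?W \<union> ?R\<close>, since the probability of \<open>?V\<close>
  factorizes.\<close>

lemma prob_no_run_step:
  assumes "1 \<le> m" "m \<le> n" "1 \<le> T"
  defines "G \<equiv> \<lambda>n. prob (no_run T m n)"
  shows "G n - G (Suc n) \<le> onset_prob T m * G (n - m)"
    and "onset_prob T m * G (n - m) - relapse_bound T m \<le> G n - G (Suc n)"
proof -
  let ?F = "\<lambda>\<omega>. \<not> run T m n \<omega> \<and> run T m (Suc n) \<omega>"
  let ?V = "{\<omega> \<in> space M. \<omega> \<in> no_run T m (n - m) \<and> ?F \<omega>}"
  let ?W = "{\<omega> \<in> space M. \<omega> \<in> no_run T m n \<and> run T m (Suc n) \<omega>}"
  let ?R = "{\<omega> \<in> space M. \<not> run T m n \<omega> \<and> run T m (Suc n) \<omega> \<and> (\<exists>k\<in>{n - m<..<n}. run T m k \<omega>)}"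
  have F: "?F \<omega> \<longleftrightarrow> card (zeros {n..n + m} \<omega> \<inter> {n..<n + m}) \<noteq> T \<and>
      card (zeros {n..n + m} \<omega> \<inter> {Suc n..<Suc n + m}) = T" for \<omega>
    by (subst (1 2) run_iff_Int[where K = "{n..n + m}"]) auto
  have N: "\<omega> \<in> no_run T m (n - m) \<longleftrightarrow> \<omega> \<in> space M \<and>
      (\<forall>k\<in>{1..n - m}. card (zeros {1..<n} \<omega> \<inter> {k..<k + m}) \<noteq> T)" for \<omega>
  proof -
    \<comment> \<open>A window starting at \<open>n - m\<close> or earlier ends at toss
      \<open>n - 1\<close> at the latest, so it avoids the tosses \<open>n, ..., n + m\<close> that
      decide the onset.\<close>
    have "run T m k \<omega> \<longleftrightarrow> card (zeros {1..<n} \<omega> \<inter> {k..<k + m}) = T" if "k \<in> {1..n - m}" for k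
      using that assms by (intro run_iff_Int) auto
    then show ?thesis by (simp add: no_run_def)
  qed
  have "prob ?V = \<P>(\<omega> in M. (\<forall>k\<in>{1..n - m}. card (zeros {1..<n} \<omega> \<inter> {k..<k + m}) \<noteq> T) \<and>
      (card (zeros {n..n + m} \<omega> \<inter> {n..<n + m}) \<noteq> T \<and>
       card (zeros {n..n + m} \<omega> \<inter> {Suc n..<Suc n + m}) = T))"
    unfolding F N by (intro arg_cong[where f = prob]) auto
  also have "\<dots> = \<P>(\<omega> in M. \<forall>k\<in>{1..n - m}. card (zeros {1..<n} \<omega> \<inter> {k..<k + m}) \<noteq> T) * \<P>(\<omega> in M. ?F \<omega>)"
    unfolding F using assms
    by (intro prob_zeros_indep[of "{1..<n}" "{n..n + m}"
        "\<lambda>S. \<forall>k\<in>{1..n - m}. card (S \<inter> {k..<k + m}) \<noteq> T"]) auto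
  also have "\<dots> = G (n - m) * onset_prob T m"
  proof -
    have "{\<omega> \<in> space M. \<forall>k\<in>{1..n - m}. card (zeros {1..<n} \<omega> \<inter> {k..<k + m}) \<noteq> T} = no_run T m (n - m)"
      using N by auto
    moreover have "\<P>(\<omega> in M. ?F \<omega>) = onset_prob T m"
      using assms by (intro prob_onset) auto
    ultimately show ?thesis by (simp only: G_def)
  qed
  finally have V: "prob ?V = onset_prob T m * G (n - m)" by simp
  have W: "prob ?W = G n - G (Suc n)"
    unfolding G_def prob_no_run_diff ..
  have runs: "{\<omega> \<in> space M. run T m k \<omega>} \<in> events" if "k \<in> {n - m<..Suc n}" for k
    using that by (intro run_event) auto
  have no_runs: "{\<omega> \<in> space M. \<omega> \<in> no_run T m k} \<in> events" for k
    using sets.Int[OF sets.top no_run_event[of T m k]] by (simp add: Int_def)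
  have evV: "?V \<in> events" and evW: "?W \<in> events"
    using assms by (intro sets.sets_Collect_conj sets.sets_Collect_neg no_runs runs; simp)+
  have evR: "?R \<in> events"
  proof -
    have "{\<omega> \<in> space M. \<exists>k\<in>{n - m<..<n}. run T m k \<omega>} \<in> events"
      using runs by (intro sets.sets_Collect_finite_Ex) auto
    then show ?thesis
      using assms by (intro sets.sets_Collect_conj sets.sets_Collect_neg runs; simp)
  qed
  have "?W \<subseteq> ?V" using assms by (auto simp: no_run_def)
  then show "G n - G (Suc n) \<le> onset_prob T m * G (n - m)"
    using finite_measure_mono[OF _ evV, of ?W] V W by simp
  have "?V \<subseteq> ?W \<union> ?R"
  proof
    fix \<omega> assume \<omega>: "\<omega> \<in> ?V"
    show "\<omega> \<in> ?W \<union> ?R"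
    proof (cases "\<exists>k\<in>{n - m<..<n}. run T m k \<omega>")
      case False
      have "\<not> run T m k \<omega>" if "k \<in> {1..n}" for k
      proof -
        from that consider "k \<in> {1..n - m}" | "k \<in> {n - m<..<n}" | "k = n" by fastforce
        then show ?thesis using False \<omega> by cases (auto simp: no_run_def)
      qed
      then show ?thesis using \<omega> by (auto simp: no_run_def)
    qed (use \<omega> in auto)
  qed
  then have "prob ?V \<le> prob (?W \<union> ?R)"
    using evW evR by (intro finite_measure_mono) auto
  also have "\<dots> \<le> prob ?W + prob ?R"
    using evW evR by (rule measure_Un_le)
  also have "prob ?R \<le> relapse_bound T m"
    using assms by (intro prob_relapse_le) auto
  finally show "onset_prob T m * G (n - m) - relapse_bound T m \<le> G n - G (Suc n)"
    using V W by simp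
qed

lemma onset_prob_nonneg: "0 \<le> onset_prob T m"
  unfolding onset_prob_def using q_pos q_less binom_mass_nonneg by simp

lemma onset_prob_le_1:
  assumes "1 \<le> m" "1 \<le> T"
  shows "onset_prob T m \<le> 1"
  unfolding prob_onset[OF assms(1) le_refl assms(2), symmetric] by (rule prob_le_1)

lemma relapse_bound_nonneg: "0 \<le> relapse_bound T m"
  unfolding relapse_bound_def by (intro sum_nonneg mult_nonneg_nonneg binom_mass_nonneg)

text \<open>The index starts at \<open>m\<close>, where the recursion becomes available; the first
  term bounds \<open>1 - G m\<close>. Each step adds one defect, and older errors do not grow
  because they are multiplied by \<open>1 - \<beta>\<close>, which lies between 0 and 1.\<close>

lemma prob_no_run_approx:
  assumes "1 \<le> m" "1 \<le> T"
  shows "\<bar>prob (no_run T m (m + j)) - (1 - onset_prob T m) ^ j\<bar> \<le>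
    real m * binom_mass m T + real j * (relapse_bound T m + onset_prob T m * (real m * binom_mass m T))"
proof (induction j)
  case 0
  have "prob (no_run T m 0) = 1" by (simp add: no_run_def prob_space)
  then have "1 - prob (no_run T m m) \<le> real m * binom_mass m T"
    using prob_no_run_lag[of T m 0 m] by simp
  then show ?case using prob_le_1[of "no_run T m m"] by simp
next
  case (Suc j)
  define G where "G = (\<lambda>n. prob (no_run T m n))"
  define \<beta> where "\<beta> = onset_prob T m"
  define \<pi> where "\<pi> = binom_mass m T"
  define D where "D = relapse_bound T m"
  have \<beta>: "0 \<le> \<beta>" "\<beta> \<le> 1" and D: "0 \<le> D"
    using onset_prob_nonneg onset_prob_le_1 relapse_bound_nonneg assms by (auto simp: \<beta>_def D_def)
  have step: "G (m + j) - G (Suc (m + j)) \<le> \<beta> * G j" "\<beta> * G j - D \<le> G (m + j) - G (Suc (m + j))"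
    using prob_no_run_step[of m "m + j" T] assms by (simp_all add: G_def \<beta>_def D_def)
  \<comment> \<open>The recursion contains \<open>G j\<close> where a geometric law needs
    \<open>G (m + j)\<close>; the exchange costs at most
    \<open>\<beta> * (m * \<pi>)\<close>.\<close>
  have "G j - G (m + j) \<le> real m * \<pi>"
    using prob_no_run_lag[of T m j m] by (simp add: G_def \<pi>_def add.commute)
  then have "\<beta> * (G j - G (m + j)) \<le> \<beta> * (real m * \<pi>)"
    using \<beta> by (intro mult_left_mono) auto
  moreover have "0 \<le> \<beta> * (G j - G (m + j))"
    using \<beta> prob_no_run_antimono[of j "m + j" T m] by (auto simp: G_def)
  ultimately have "\<bar>G (Suc (m + j)) - (1 - \<beta>) * G (m + j)\<bar> \<le> D + \<beta> * (real m * \<pi>)"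
    using step D by (simp add: algebra_simps abs_le_iff)
  moreover have "\<bar>(1 - \<beta>) * (G (m + j) - (1 - \<beta>) ^ j)\<bar> \<le> 1 * \<bar>G (m + j) - (1 - \<beta>) ^ j\<bar>"
    unfolding abs_mult using \<beta> by (intro mult_right_mono) auto
  moreover have "G (Suc (m + j)) - (1 - \<beta>) ^ Suc j =
      (G (Suc (m + j)) - (1 - \<beta>) * G (m + j)) + (1 - \<beta>) * (G (m + j) - (1 - \<beta>) ^ j)"
    by (simp add: algebra_simps)
  moreover have "\<bar>G (m + j) - (1 - \<beta>) ^ j\<bar> \<le> real m * \<pi> + real j * (D + \<beta> * (real m * \<pi>))"
    using Suc unfolding G_def \<beta>_def \<pi>_def D_def .
  ultimately have "\<bar>G (m + Suc j) - (1 - \<beta>) ^ Suc j\<bar> \<le> real m * \<pi> + real (Suc j) * (D + \<beta> * (real m * \<pi>))"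
    by (simp add: algebra_simps)
  then show ?case unfolding G_def \<beta>_def \<pi>_def D_def .
qed

section \<open>Size of \<beta> and of the relapse bound relative to \<pi>\<close>

text \<open>The absorption identities for binomial coefficients turn both masses for
  \<open>m - 1\<close> tosses into multiples of \<open>binom_mass m T\<close>, with factors
  \<open>m - T\<close> and \<open>T\<close>. Hence \<beta> / \<pi> differs from \<open>q\<close> by
  a term of order \<open>1 / m\<close>.\<close>

lemma onset_prob_eq:
  assumes "1 \<le> T" "T < m"
  shows "real m * onset_prob T m = (q * real m + (1 - 2 * q) * real T) * binom_mass m T"
proof -
  obtain t where T: "T = Suc t" using assms by (cases T) auto
  have "real ((m - T) * (m choose T)) = real (m * (m - 1 choose T))"
    by (simp only: binomial_absorb_comp)
  then have 1: "real m * real (m - 1 choose T) = (real m - real T) * real (m choose T)"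
    using assms by (simp add: of_nat_diff)
  have "real (Suc t * (m choose Suc t)) = real (m * (m - 1 choose t))"
    by (simp only: binomial_absorption)
  then have 2: "real m * real (m - 1 choose (T - 1)) = real T * real (m choose T)"
    by (simp add: T algebra_simps)
  have "m - T = Suc (m - 1 - T)" using assms by simp
  then have p1: "(1 - q) ^ (m - T) = (1 - q) * (1 - q) ^ (m - 1 - T)" by (metis power_Suc)
  have p2: "(1 - q) ^ (m - 1 - (T - 1)) = (1 - q) ^ (m - T)" and q1: "q ^ T = q * q ^ (T - 1)"
    using T by simp_all
  have "real m * ((1 - q) * binom_mass (m - 1) T) = (real m * real (m - 1 choose T)) * q ^ T * (1 - q) ^ (m - T)"
    by (simp add: binom_mass_def p1)
  also have "\<dots> = (real m - real T) * binom_mass m T"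
    unfolding 1 by (simp add: binom_mass_def)
  finally have A: "real m * ((1 - q) * binom_mass (m - 1) T) = (real m - real T) * binom_mass m T" .
  have "real m * (q * binom_mass (m - 1) (T - 1)) =
      (real m * real (m - 1 choose (T - 1))) * q ^ T * (1 - q) ^ (m - T)"
    unfolding binom_mass_def p2 by (simp add: q1)
  also have "\<dots> = real T * binom_mass m T"
    unfolding 2 by (simp add: binom_mass_def)
  finally have B: "real m * (q * binom_mass (m - 1) (T - 1)) = real T * binom_mass m T" .
  have "real m * onset_prob T m = q * (real m * ((1 - q) * binom_mass (m - 1) T)) +
      (1 - q) * (real m * (q * binom_mass (m - 1) (T - 1)))"
    by (simp add: onset_prob_def algebra_simps)
  also have "\<dots> = (q * real m + (1 - 2 * q) * real T) * binom_mass m T"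
    unfolding A B by (simp add: algebra_simps)
  finally show ?thesis .
qed

lemma binom_mass_pos: "c \<le> l \<Longrightarrow> 0 < binom_mass l c"
  using q_pos q_less by (simp add: binom_mass_def)

lemma onset_ratio_tendsto:
  assumes "1 \<le> T"
  shows "(\<lambda>m. onset_prob T m / binom_mass m T) \<longlonglongrightarrow> q"
proof -
  have "\<forall>\<^sub>F m in sequentially. q + (1 - 2 * q) * real T / real m = onset_prob T m / binom_mass m T"
    using eventually_gt_at_top[of T]
  proof eventually_elim
    case (elim m)
    then have "0 < real m" "0 < binom_mass m T" by (auto simp: binom_mass_pos)
    then show ?case using onset_prob_eq[OF assms elim] by (simp add: field_simps)
  qed
  moreover have "(\<lambda>m. q + (1 - 2 * q) * real T / real m) \<longlonglongrightarrow> q + 0"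
    by (intro tendsto_add tendsto_const lim_const_over_n)
  ultimately show ?thesis by (simp add: tendsto_cong)
qed

text \<open>Uses \<open>l choose c \<le> l ^ c\<close> and \<open>q ^ c \<le> 1\<close>. The full
  exponent \<open>l\<close> is kept so that the exponents of several blocks can be added.\<close>

lemma binom_mass_le: "binom_mass l c \<le> real l ^ c * (1 - q) ^ l / (1 - q) ^ c"
proof (cases "c \<le> l")
  case True
  have "real (l choose c) * q ^ c \<le> real l ^ c * 1"
    using True q_pos q_less binomial_le_pow[OF True]
    by (intro mult_mono power_le_one) (auto simp flip: of_nat_power)
  then have "real (l choose c) * q ^ c * (1 - q) ^ (l - c) \<le> real l ^ c * (1 - q) ^ (l - c)"
    using q_less by (intro mult_right_mono) auto
  then show ?thesis
    using True q_less by (simp add: binom_mass_def power_diff)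
next
  case False
  then have "binom_mass l c = 0" by (simp add: binom_mass_def binomial_eq_0)
  then show ?thesis using q_less by simp
qed

text \<open>A lower bound of the true order \<open>m ^ T * (1 - q) ^ m\<close>, to be used in a
  denominator.\<close>

lemma binom_mass_ge:
  assumes "T \<le> m"
  shows "(real m / real T) ^ T * q ^ T * (1 - q) ^ m \<le> binom_mass m T"
  unfolding binom_mass_def using q_pos q_less
  by (intro mult_mono binomial_ge_n_over_k_pow_k assms power_decreasing) auto

text \<open>Geometric decay beats the polynomial factor: one window length is negligible on the
  scale 1 / \<pi>.\<close>

lemma mult_binom_mass_tendsto_0: "(\<lambda>m. real m * binom_mass m T) \<longlonglongrightarrow> 0"
proof (rule tendsto_sandwich[OF _ _ tendsto_const])
  show "(\<lambda>m. real m ^ Suc T * (1 - q) ^ m / (1 - q) ^ T) \<longlonglongrightarrow> 0"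
    using q_pos q_less by (intro tendsto_divide_zero summable_LIMSEQ_zero summable_power_times_geometric) auto
  show "\<forall>\<^sub>F m in sequentially. 0 \<le> real m * binom_mass m T"
    by (simp add: binom_mass_nonneg)
  show "\<forall>\<^sub>F m in sequentially. real m * binom_mass m T \<le> real m ^ Suc T * (1 - q) ^ m / (1 - q) ^ T"
    using mult_left_mono[OF binom_mass_le] by (intro always_eventually allI) (simp add: mult_ac)
qed

text \<open>The three blocks have total length \<open>m + i + 1\<close>, and the surplus factor
  \<open>(1 - q) ^ (i + 1)\<close> makes the sum over \<open>i\<close> converge. As
  \<open>c \<ge> 1\<close>, the middle block has at most \<open>T - 1\<close> zeros, which saves one
  power of \<open>m\<close> compared with \<pi>.\<close>

lemma relapse_bound_le:
  assumes "1 \<le> T"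
  obtains C where "\<And>m. relapse_bound T m \<le> C * (real m ^ (T - 1) * (1 - q) ^ m)"
proof
  fix m
  define p where "p = 1 - q"
  have p: "0 < p" "p < 1" using q_pos q_less by (auto simp: p_def)
  \<comment> \<open>Collects the dependence on the length \<open>i + 1\<close> of the outer blocks;
    two factors of degree \<open>c \<le> T\<close> give the exponent \<open>2 * T\<close>.\<close>
  define g where "g = (\<lambda>i. real i ^ (2 * T) * p ^ i)"
  have "summable g" unfolding g_def using p by (intro summable_power_times_geometric) auto
  have g: "0 \<le> g i" for i using p by (simp add: g_def)
  have summand: "binom_mass (Suc i) c * binom_mass (m - 1 - i) (T - c) * binom_mass (Suc i) c
      \<le> real m ^ (T - 1) * p ^ m / p ^ (2 * T) * g (Suc i)"
    if i: "i \<in> {1..<m}" and c: "c \<in> {1..T}" for i c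
  proof -
    have "binom_mass (Suc i) c * binom_mass (m - 1 - i) (T - c) * binom_mass (Suc i) c \<le>
        (real (Suc i) ^ c * p ^ Suc i / p ^ c) * (real (m - 1 - i) ^ (T - c) * p ^ (m - 1 - i) / p ^ (T - c)) *
        (real (Suc i) ^ c * p ^ Suc i / p ^ c)"
      unfolding p_def using q_less by (intro mult_mono binom_mass_le mult_nonneg_nonneg binom_mass_nonneg) auto
    also have "\<dots> = (real (Suc i) ^ c * real (Suc i) ^ c * real (m - 1 - i) ^ (T - c)) *
        (p ^ Suc i * p ^ (m - 1 - i) * p ^ Suc i) / (p ^ c * p ^ c * p ^ (T - c))"
      by (simp add: mult_ac)
    also have "real (Suc i) ^ c * real (Suc i) ^ c = real (Suc i) ^ (2 * c)"
      by (simp only: power_add[symmetric] mult_2)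
    also have "p ^ Suc i * p ^ (m - 1 - i) * p ^ Suc i = p ^ m * p ^ Suc i"
      using i by (simp only: power_add[symmetric]) simp
    also have "p ^ c * p ^ c * p ^ (T - c) = p ^ (T + c)"
      using c by (simp only: power_add[symmetric]) (simp add: add.commute)
    also have "real (Suc i) ^ (2 * c) * real (m - 1 - i) ^ (T - c) * (p ^ m * p ^ Suc i) / p ^ (T + c) \<le>
        real (Suc i) ^ (2 * T) * real m ^ (T - 1) * (p ^ m * p ^ Suc i) / p ^ (2 * T)"
    proof (intro frac_le mult_right_mono mult_mono)
      have "real (m - 1 - i) ^ (T - c) \<le> real m ^ (T - c)" by (intro power_mono) auto
      also have "\<dots> \<le> real m ^ (T - 1)" using i c by (intro power_increasing) auto
      finally show "real (m - 1 - i) ^ (T - c) \<le> real m ^ (T - 1)" .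
      show "real (Suc i) ^ (2 * c) \<le> real (Suc i) ^ (2 * T)"
        using c by (intro power_increasing) auto
      show "p ^ (2 * T) \<le> p ^ (T + c)" using p c by (intro power_decreasing) auto
    qed (use p in auto)
    also have "\<dots> = real m ^ (T - 1) * p ^ m / p ^ (2 * T) * g (Suc i)"
      by (simp add: g_def)
    finally show ?thesis .
  qed
  have "relapse_bound T m \<le> (\<Sum>i\<in>{1..<m}. \<Sum>c\<in>{1..T}. real m ^ (T - 1) * p ^ m / p ^ (2 * T) * g (Suc i))"
    unfolding relapse_bound_def by (intro sum_mono summand)
  also have "\<dots> = real T * (real m ^ (T - 1) * p ^ m / p ^ (2 * T)) * (\<Sum>i\<in>{1..<m}. g (Suc i))"
    by (simp add: sum_distrib_left mult.assoc)
  also have "\<dots> \<le> real T * (real m ^ (T - 1) * p ^ m / p ^ (2 * T)) * suminf g"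
  proof (intro mult_left_mono)
    have "(\<Sum>i\<in>{1..<m}. g (Suc i)) = sum g (Suc ` {1..<m})"
      by (subst sum.reindex) auto
    also have "\<dots> \<le> suminf g"
      using \<open>summable g\<close> g by (intro sum_le_suminf) auto
    finally show "(\<Sum>i\<in>{1..<m}. g (Suc i)) \<le> suminf g" .
  qed (use p in auto)
  \<comment> \<open>This fixes the constant \<open>C\<close>; written out in \<open>q\<close> and
    \<open>T\<close>, it does not depend on \<open>m\<close>.\<close>
  finally show "relapse_bound T m \<le> (real T / (1 - q) ^ (2 * T) *
      (\<Sum>i. real i ^ (2 * T) * (1 - q) ^ i)) * (real m ^ (T - 1) * (1 - q) ^ m)"
    by (simp only: p_def[symmetric] g_def[symmetric]) (simp add: mult_ac)
qed

text \<open>The numerator has one power of \<open>m\<close> less than the denominator, so the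
  quotient is at most a constant over \<open>m\<close>.\<close>

lemma relapse_ratio_tendsto:
  assumes "1 \<le> T"
  shows "(\<lambda>m. relapse_bound T m / binom_mass m T) \<longlonglongrightarrow> 0"
proof -
  obtain C where C: "\<And>m. relapse_bound T m \<le> C * (real m ^ (T - 1) * (1 - q) ^ m)"
    using relapse_bound_le[OF assms] by metis
  define K where "K = C * real T ^ T / q ^ T"
  have upper: "\<forall>\<^sub>F m in sequentially. relapse_bound T m / binom_mass m T \<le> K / real m"
    using eventually_ge_at_top[of T]
  proof eventually_elim
    case (elim m)
    have pos: "0 < real m" "0 < real T" "0 < (1 - q) ^ m" "0 < q ^ T"
      using elim assms q_pos q_less by auto
    let ?L = "(real m / real T) ^ T * q ^ T * (1 - q) ^ m"
    have "relapse_bound T m / binom_mass m T \<le> relapse_bound T m / ?L"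
      using pos by (intro divide_left_mono binom_mass_ge elim relapse_bound_nonneg mult_pos_pos binom_mass_pos) auto
    also have "\<dots> \<le> C * (real m ^ (T - 1) * (1 - q) ^ m) / ?L"
      using pos by (intro divide_right_mono C) auto
    also have "\<dots> = K / real m"
    proof -
      have "real m ^ T = real m * real m ^ (T - 1)"
        using assms by (cases T) auto
      then have "?L = real m * real m ^ (T - 1) / real T ^ T * q ^ T * (1 - q) ^ m"
        by (simp add: power_divide)
      then show ?thesis using pos q_less by (simp add: K_def)
    qed
    finally show ?case .
  qed
  have "\<forall>\<^sub>F m in sequentially. 0 \<le> relapse_bound T m / binom_mass m T"
    by (simp add: relapse_bound_nonneg binom_mass_nonneg)
  then show ?thesis
    by (rule tendsto_sandwich[OF _ upper tendsto_const lim_const_over_n])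
qed

section \<open>The exponential limit law\<close>

text \<open>\<open>N m\<close> counts tosses and \<open>N m - m + 1\<close> counts starts. These
  numbers differ negligibly on the scale 1 / \<pi>, so the geometric approximation has total rate
  tending to \<open>q * y\<close> and an error tending to 0.\<close>

lemma prob_no_run_tendsto:
  assumes "1 \<le> T" and N: "(\<lambda>m. real (N m) * binom_mass m T) \<longlonglongrightarrow> y" and "0 < y"
  shows "(\<lambda>m. prob (no_run T m (N m - m + 1))) \<longlonglongrightarrow> exp (- (q * y))"
proof -
  define \<pi> where "\<pi> = (\<lambda>m. binom_mass m T)"
  define \<beta> where "\<beta> = onset_prob T"
  define D where "D = relapse_bound T"
  \<comment> \<open>Chosen so that \<open>N m - m + 1 = m + j m\<close>, as in
    \<open>prob_no_run_approx\<close>. The subtraction is eventually not truncated, because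
    \<open>N m * \<pi> m\<close> has a positive limit while \<open>m * \<pi> m\<close>
    vanishes.\<close>
  define j where "j = (\<lambda>m. N m + 1 - 2 * m)"
  have m\<pi>: "(\<lambda>m. real m * \<pi> m) \<longlonglongrightarrow> 0"
    unfolding \<pi>_def by (rule mult_binom_mass_tendsto_0)
  have \<pi>: "\<pi> \<longlonglongrightarrow> 0"
  proof (rule tendsto_sandwich[OF _ _ tendsto_const m\<pi>])
    show "\<forall>\<^sub>F m in sequentially. 0 \<le> \<pi> m" by (simp add: \<pi>_def binom_mass_nonneg)
    show "\<forall>\<^sub>F m in sequentially. \<pi> m \<le> real m * \<pi> m"
      using eventually_ge_at_top[of 1]
    proof eventually_elim
      case (elim m)
      then show ?case using mult_right_mono[of 1 "real m" "\<pi> m"] by (simp add: \<pi>_def binom_mass_nonneg)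
    qed
  qed
  have \<pi>_pos: "\<forall>\<^sub>F m in sequentially. 0 < \<pi> m"
    using eventually_ge_at_top[of T] by eventually_elim (simp add: \<pi>_def binom_mass_pos)
  have "(\<lambda>m. real (N m) * \<pi> m - 2 * (real m * \<pi> m)) \<longlonglongrightarrow> y - 2 * 0"
    using N unfolding \<pi>_def[symmetric] by (intro tendsto_intros m\<pi>) (simp add: \<pi>_def)
  then have "\<forall>\<^sub>F m in sequentially. 0 < real (N m) * \<pi> m - 2 * (real m * \<pi> m)"
    using \<open>0 < y\<close> by (intro order_tendstoD) auto
  then have large: "\<forall>\<^sub>F m in sequentially. 2 * m < N m"
    using \<pi>_pos
  proof eventually_elim
    case (elim m)
    then have "0 < (real (N m) - 2 * real m) * \<pi> m" by (simp add: algebra_simps)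
    then show ?case using elim by (simp add: zero_less_mult_iff)
  qed
  have j\<pi>: "(\<lambda>m. real (j m) * \<pi> m) \<longlonglongrightarrow> y"
  proof (rule Lim_transform_eventually)
    have "(\<lambda>m. real (N m) * \<pi> m + \<pi> m - 2 * (real m * \<pi> m)) \<longlonglongrightarrow> y + 0 - 2 * 0"
      using N by (intro tendsto_intros m\<pi> \<pi>) (simp add: \<pi>_def)
    then show "(\<lambda>m. real (N m) * \<pi> m + \<pi> m - 2 * (real m * \<pi> m)) \<longlonglongrightarrow> y" by simp
    show "\<forall>\<^sub>F m in sequentially. real (N m) * \<pi> m + \<pi> m - 2 * (real m * \<pi> m) = real (j m) * \<pi> m"
      using large by eventually_elim (simp add: j_def of_nat_diff algebra_simps)
  qed
  have \<beta>\<pi>: "(\<lambda>m. \<beta> m / \<pi> m) \<longlonglongrightarrow> q" and D\<pi>: "(\<lambda>m. D m / \<pi> m) \<longlonglongrightarrow> 0"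
    unfolding \<beta>_def \<pi>_def D_def using assms(1) onset_ratio_tendsto relapse_ratio_tendsto by auto
  have \<beta>: "\<beta> \<longlonglongrightarrow> 0"
  proof (rule Lim_transform_eventually)
    show "(\<lambda>m. \<beta> m / \<pi> m * \<pi> m) \<longlonglongrightarrow> 0" using tendsto_mult[OF \<beta>\<pi> \<pi>] by simp
    show "\<forall>\<^sub>F m in sequentially. \<beta> m / \<pi> m * \<pi> m = \<beta> m"
      using \<pi>_pos by eventually_elim simp
  qed
  have "(\<lambda>m. real (j m) * \<beta> m) \<longlonglongrightarrow> q * y"
  proof (rule Lim_transform_eventually)
    show "(\<lambda>m. \<beta> m / \<pi> m * (real (j m) * \<pi> m)) \<longlonglongrightarrow> q * y" by (intro tendsto_mult \<beta>\<pi> j\<pi>)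
    show "\<forall>\<^sub>F m in sequentially. \<beta> m / \<pi> m * (real (j m) * \<pi> m) = real (j m) * \<beta> m"
      using \<pi>_pos by eventually_elim simp
  qed
  then have limit: "(\<lambda>m. (1 - \<beta> m) ^ j m) \<longlonglongrightarrow> exp (- (q * y))"
    by (intro power_one_minus_tendsto_exp \<beta>) (auto simp: \<beta>_def onset_prob_nonneg)
  \<comment> \<open>The bound of \<open>prob_no_run_approx\<close>, rearranged into factors that
    each have a limit.\<close>
  define err where "err = (\<lambda>m. real m * \<pi> m + real (j m) * \<pi> m * (D m / \<pi> m + \<beta> m / \<pi> m * (real m * \<pi> m)))"
  have "err \<longlonglongrightarrow> 0 + y * (0 + q * 0)"
    unfolding err_def by (intro tendsto_intros m\<pi> j\<pi> D\<pi> \<beta>\<pi>)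
  then have err: "err \<longlonglongrightarrow> 0" by simp
  have "\<forall>\<^sub>F m in sequentially. norm (prob (no_run T m (N m - m + 1)) - (1 - \<beta> m) ^ j m) \<le> err m"
    using large \<pi>_pos eventually_ge_at_top[of 1]
  proof eventually_elim
    case (elim m)
    then have "N m - m + 1 = m + j m" by (simp add: j_def)
    then have "norm (prob (no_run T m (N m - m + 1)) - (1 - \<beta> m) ^ j m) \<le>
        real m * \<pi> m + real (j m) * (D m + \<beta> m * (real m * \<pi> m))"
      using prob_no_run_approx[OF elim(3) assms(1), of "j m"] by (simp add: \<pi>_def \<beta>_def D_def)
    also have "\<dots> = err m" using elim by (simp add: err_def field_simps)
    finally show ?case .
  qed
  then have "(\<lambda>m. prob (no_run T m (N m - m + 1)) - (1 - \<beta> m) ^ j m) \<longlonglongrightarrow> 0"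
    by (rule Lim_null_comparison[OF _ err])
  from tendsto_add[OF this limit] show ?thesis by simp
qed

text \<open>The hitting time is an integer or \<infinity>, so its product with
  \<open>c m > 0\<close> exceeds \<open>x\<close> exactly if it exceeds \<open>N m\<close>, the
  integer part of \<open>x / c m\<close>. Since \<open>N m * \<pi> m\<close> tends to
  \<open>x / q\<close>, the rate \<open>q\<close> cancels.\<close>

lemma hitting_time_tendsto:
  assumes "1 \<le> T" and a: "a \<longlonglongrightarrow> q" and "0 < x"
  shows "(\<lambda>m. \<P>(\<omega> in M. ereal_of_enat (hitting_time X T m \<omega>) * ereal (a m) * ereal (binom_mass m T) > ereal x))
    \<longlonglongrightarrow> exp (- x)"
proof -
  define \<pi> where "\<pi> = (\<lambda>m. binom_mass m T)"
  define c where "c = (\<lambda>m. a m * \<pi> m)"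
  define N where "N = (\<lambda>m. nat \<lfloor>x / c m\<rfloor>)"
  have m\<pi>: "(\<lambda>m. real m * \<pi> m) \<longlonglongrightarrow> 0"
    unfolding \<pi>_def by (rule mult_binom_mass_tendsto_0)
  have \<pi>_pos: "\<forall>\<^sub>F m in sequentially. 0 < \<pi> m"
    using eventually_ge_at_top[of T] by eventually_elim (simp add: \<pi>_def binom_mass_pos)
  have a_pos: "\<forall>\<^sub>F m in sequentially. 0 < a m"
    using order_tendstoD(1)[OF a q_pos] .
  have "(\<lambda>m. a m * (real m * \<pi> m)) \<longlonglongrightarrow> q * 0" by (intro tendsto_mult a m\<pi>)
  then have mc: "(\<lambda>m. real m * c m) \<longlonglongrightarrow> 0" by (simp add: c_def mult_ac)
  have c_pos: "\<forall>\<^sub>F m in sequentially. 0 < c m"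
    using \<pi>_pos a_pos by eventually_elim (simp add: c_def)
  have c0: "c \<longlonglongrightarrow> 0"
  proof (rule tendsto_sandwich[OF _ _ tendsto_const mc])
    show "\<forall>\<^sub>F m in sequentially. 0 \<le> c m" using c_pos by eventually_elim simp
    show "\<forall>\<^sub>F m in sequentially. c m \<le> real m * c m"
      using eventually_ge_at_top[of 1] c_pos by eventually_elim simp
  qed
  have Nc: "(\<lambda>m. real (N m) * c m) \<longlonglongrightarrow> x"
  proof (rule tendsto_sandwich)
    show "(\<lambda>m. x - c m) \<longlonglongrightarrow> x" using tendsto_diff[OF tendsto_const c0, of x] by simp
    show "\<forall>\<^sub>F m in sequentially. x - c m \<le> real (N m) * c m"
      using c_pos
    proof eventually_elim
      case (elim m)
      have "x / c m - 1 \<le> real (N m)" using elim \<open>0 < x\<close> by (simp add: N_def)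
      then have "(x / c m - 1) * c m \<le> real (N m) * c m" using elim by (intro mult_right_mono) auto
      then show ?case using elim by (simp add: left_diff_distrib)
    qed
    show "\<forall>\<^sub>F m in sequentially. real (N m) * c m \<le> x"
      using c_pos
    proof eventually_elim
      case (elim m)
      have "real (N m) \<le> x / c m" using elim \<open>0 < x\<close> by (simp add: N_def)
      then show ?case using elim by (simp add: field_simps)
    qed
  qed auto
  have N\<pi>: "(\<lambda>m. real (N m) * binom_mass m T) \<longlonglongrightarrow> x / q"
  proof (rule Lim_transform_eventually)
    show "(\<lambda>m. real (N m) * c m / a m) \<longlonglongrightarrow> x / q"
      using q_pos by (intro tendsto_divide Nc a) auto
    show "\<forall>\<^sub>F m in sequentially. real (N m) * c m / a m = real (N m) * binom_mass m T"
      using a_pos by eventually_elim (simp add: c_def \<pi>_def)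
  qed
  have "(\<lambda>m. real (N m) * c m - real m * c m) \<longlonglongrightarrow> x - 0" by (intro tendsto_diff Nc mc)
  then have "\<forall>\<^sub>F m in sequentially. 0 < real (N m) * c m - real m * c m"
    using \<open>0 < x\<close> by (intro order_tendstoD) auto
  then have large: "\<forall>\<^sub>F m in sequentially. m < N m"
    using c_pos
  proof eventually_elim
    case (elim m)
    then have "0 < (real (N m) - real m) * c m" by (simp add: algebra_simps)
    then show ?case using elim by (simp add: zero_less_mult_iff)
  qed
  have "\<forall>\<^sub>F m in sequentially. prob (no_run T m (N m - m + 1)) =
      \<P>(\<omega> in M. ereal_of_enat (hitting_time X T m \<omega>) * ereal (a m) * ereal (binom_mass m T) > ereal x)"
    using large a_pos \<pi>_pos c_pos eventually_ge_at_top[of 1]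
  proof eventually_elim
    case (elim m)
    \<comment> \<open>If no run ever occurs, \<open>h\<close> is \<infinity> and both sides hold, as
      \<open>a m\<close> and \<open>binom_mass m T\<close> are positive.\<close>
    have "ereal_of_enat h * ereal (a m) * ereal (binom_mass m T) > ereal x \<longleftrightarrow> enat (N m) < h" for h
    proof (cases h)
      case (enat k)
      have "real k * c m > x \<longleftrightarrow> x / c m < real k" using elim by (simp add: field_simps)
      also have "\<dots> \<longleftrightarrow> N m < k" using elim \<open>0 < x\<close> by (simp add: N_def floor_less_iff nat_less_iff)
      finally show ?thesis by (simp add: enat c_def \<pi>_def mult.assoc)
    next
      case infinity
      then show ?thesis using elim by (simp add: \<pi>_def)
    qed
    then show ?case
      using hitting_time_greater_iff[of m "N m" X T] elim by (simp add: no_run_def)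
  qed
  moreover have "(\<lambda>m. prob (no_run T m (N m - m + 1))) \<longlonglongrightarrow> exp (- (q * (x / q)))"
    using assms q_pos N\<pi> by (intro prob_no_run_tendsto) auto
  ultimately show ?thesis using q_pos by (simp add: tendsto_cong)
qed

end

section \<open>The normalising factor and the final statement\<close>

lemma alpha_tendsto:
  assumes "0 < p" "p < 1"
  shows "alpha T p \<longlonglongrightarrow> 1 - p"
proof (cases "T = 1")
  case True
  have "(\<lambda>m. (2 * p ^ (m - 1) - 1) / real m) \<longlonglongrightarrow> 0"
  proof (rule Lim_null_comparison[OF always_eventually lim_const_over_n[of 1]], rule allI)
    fix m
    have "0 \<le> p ^ (m - 1)" "p ^ (m - 1) \<le> 1" using assms by (auto intro: power_le_one)
    then have "\<bar>2 * p ^ (m - 1) - 1\<bar> \<le> 1" by linarith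
    then show "norm ((2 * p ^ (m - 1) - 1) / real m) \<le> 1 / real m"
      by (simp add: divide_right_mono)
  qed
  from tendsto_add[OF tendsto_const this, of "1 - p"] show ?thesis
    using True by (simp add: alpha_def[abs_def])
next
  case False
  from tendsto_diff[OF tendsto_const lim_const_over_n, of "1 - p" 2] show ?thesis
    using False by (simp add: alpha_def[abs_def])
qed

text \<open>The product is taken in the extended reals because the hitting time may be \<infinity>.
  As \<open>exp (- x)\<close> is a non-zero constant, the asymptotic equivalence follows from the
  limit in \<open>hitting_time_tendsto\<close> with \<open>a = alpha T p\<close>.\<close>

theorem theorem2p1:
  fixes M :: "'a measure" and X :: "nat \<Rightarrow> 'a \<Rightarrow> real" and p q x :: real and T :: nat
    and A :: "nat \<Rightarrow> nat \<Rightarrow> 'a set"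
  assumes "prob_space M"
    and "prob_space.indep_vars M (\<lambda>_. borel) X {1..}"
    and "0 < p" "p < 1" and "q = 1 - p"
    and "\<And>i. i \<ge> 1 \<Longrightarrow> measure M {\<omega> \<in> space M. X i \<omega> = 1} = p"
    and "\<And>i. i \<ge> 1 \<Longrightarrow> measure M {\<omega> \<in> space M. X i \<omega> = 0} = q"
    and "T = 1 \<or> T = 2"
    and "\<And>n m. A n m = {\<omega> \<in> space M. contaminated_run X T m n \<omega>}"
    and "x > 0"
  shows "(\<lambda>m. measure M {\<omega> \<in> space M.
             ereal_of_enat (hitting_time X T m \<omega>) * ereal (alpha T p m)
               * ereal (measure M (A 1 m)) > ereal x})
           \<sim>[at_top] (\<lambda>_. exp (- x))
         \<and> (\<forall>m\<ge>1. measure M (A 1 m) =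
               (if T = 1 then real m * p ^ (m - 1) * q
                else real (m choose 2) * p ^ (m - 2) * q ^ 2))"
proof -
  interpret prob_space M by fact
  interpret iid_tosses M X q
    using assms by unfold_locales auto
  have A: "measure M (A 1 m) = binom_mass m T" for m
    unfolding assms(9) by (rule prob_run) simp
  have "(\<lambda>m. measure M {\<omega> \<in> space M. ereal_of_enat (hitting_time X T m \<omega>) * ereal (alpha T p m)
               * ereal (measure M (A 1 m)) > ereal x}) \<longlonglongrightarrow> exp (- x)"
    unfolding A using assms alpha_tendsto[of p T] by (intro hitting_time_tendsto) auto
  moreover have "binom_mass m T = (if T = 1 then real m * p ^ (m - 1) * q
      else real (m choose 2) * p ^ (m - 2) * q ^ 2)" for m
    unfolding binom_mass_def using assms(5,8) by auto
  ultimately show ?thesis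
    unfolding A by (intro conjI tendsto_imp_asymp_equiv_const) auto
qed

end
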